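(* Let $(\mathcal{A},\Omega)$ be a commutative (i.e. $\mathcal{A}$ is commutative) regular abstract $O^*$-algebra. If $\mathcal{B}(\mathcal{A},\Omega)$, the set of bounded elements, is weakly dense in $\mathcal{A}$, then $\mathcal{S}_{\mathrm{p}}(\mathcal{A},\Omega) = \mathcal{M}(\mathcal{A},\Omega)$, i.e. the pure states of $(\mathcal{A},\Omega)$ are precisely its characters.
   Context: All $^*$-algebras are associative, unital (unit $\mathbb{1}$) and over $\mathbb{C}$. For a $^*$-algebra $\mathcal{A}$, $\mathcal{A}_{\mathrm H}:=\{a\in\mathcal{A} : a=a^*\}$. A quasi-ordered $^*$-algebra is a $^*$-algebra $\mathcal{A}$ with a reflexive and transitive relation $\lesssim$ on $\mathcal{A}_{\mathrm H}$ such that for all $a,b\in\mathcal{A}_{\mathrm H}$ with $a\lesssim b$, all $c\in\mathcal{A}_{\mathrm H}$, $d\in\mathcal{A}$: $a+c\lesssim b+c$, $d^*ad\lesssim d^*bd$, and $0\lesssim\mathbb{1}$. Put $\mathcal{A}^+_{\mathrm H}:=\{a\in\mathcal{A}_{\mathrm H} : 0\lesssim a\}$. $\mathcal{A}^*$ is the space of all linear functionals $\mathcal{A}\to\mathbb{C}$, with dual pairing $\langle\omega,a\rangle$. For $\omega\in\mathcal{A}^*$ and $a,b,c\in\mathcal{A}$: $\langle\omega^*,a\rangle:=\overline{\langle\omega,a^*\rangle}$; $\langle b\cdot\omega\cdot c,a\rangle:=\langle\omega,cab\rangle$ (an $\mathcal{A}$-bimodule structure); $a\triangleright\omega:=a\cdot\omega\cdot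 a^*$, i.e. $\langle a\triangleright\omega,x\rangle=\langle\omega,a^*xa\rangle$. Put $\mathcal{A}^*_{\mathrm H}:=\{\omega : \omega^*=\omega\}$, partially ordered by $\omega\le\rho$ iff $\langle\omega,a\rangle\le\langle\rho,a\rangle$ for all $a\in\mathcal{A}^+_{\mathrm H}$, and $\mathcal{A}^{*,+}_{\mathrm H}:=\{\omega\in\mathcal{A}^*_{\mathrm H} : \omega\ge0\}$. A functional $\omega$ is algebraically positive if $\langle\omega,a^*a\rangle\ge0$ for all $a\in\mathcal{A}$. An abstract $O^*$-algebra is a pair $(\mathcal{A},\Omega)$ of a quasi-ordered $^*$-algebra $\mathcal{A}$ and a linear subspace and $\mathcal{A}$-subbimodule $\Omega\subseteq\mathcal{A}^*$ stable under $\omega\mapsto\omega^*$ such that, with $\Omega_{\mathrm H}:=\Omega\cap\mathcal{A}^*_{\mathrm H}$ and $\Omega^+_{\mathrm H}:=\Omega\cap\mathcal{A}^{*,+}_{\mathrm H}$, $\Omega$ is the linear span of $\Omega^+_{\mathrm H}$ and $\mathcal{A}^+_{\mathrm H}=\{a\in\mathcal{A}_{\mathrm H} : \langle\omega,a\rangle\ge0\text{ for all }\omega\in\Omega^+_{\mathrm H}\}$. States: $\mathcal{S}(\mathcal{A},\Omega):=\{\omega\in\Omega^+_{\mathrm H} : \langle\omega,\mathbb{1}\rangle=1\}$; pure states: $\mathcal{S}_{\mathrm p}(\mathcal{A},\Omega)$ is the set of extreme points of the convex set $\mathcal{S}(\mathcal{A},\Omega)$; characters: $\mathcal{M}(\mathcal{A},\Omega)$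 is the set of $\omega\in\mathcal{S}(\mathcal{A},\Omega)$ with $\langle\omega,ab\rangle=\langle\omega,a\rangle\langle\omega,b\rangle$ for all $a,b\in\mathcal{A}$. $(\mathcal{A},\Omega)$ is regular if every algebraically positive $\omega\in\Omega_{\mathrm H}$ is an element of $\Omega^+_{\mathrm H}$. For $\omega\in\mathcal{S}(\mathcal{A},\Omega)$ and $a\in\mathcal{A}$ let $\|a\|_{\omega,\infty}:=\sup\{\sqrt{\langle b\triangleright\omega,a^*a\rangle} : b\in\mathcal{A},\ \langle\omega,b^*b\rangle=1\}\in[0,\infty]$, $\mathcal{B}_\omega(\mathcal{A},\Omega):=\{a\in\mathcal{A} : \|a\|_{\omega,\infty}<\infty\}$ and $\mathcal{B}(\mathcal{A},\Omega):=\bigcap_{\omega\in\mathcal{S}(\mathcal{A},\Omega)}\mathcal{B}_\omega(\mathcal{A},\Omega)$. The weak topology on $\mathcal{A}$ is the locally convex topology defined by the seminorms $a\mapsto|\langle\omega,a\rangle|$, $\omega\in\Omega$. *)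

theory Defs
  imports
    "HOL-Analysis.Analysis"
    "HOL-Library.Complex_Order"
    "HOL-Library.Function_Algebras"
begin

text \<open>
  Inequalities between complex numbers are those of \<open>Complex_Order\<close>: \<open>z \<le> w\<close> iff \<open>w - z\<close> is real
  and nonnegative.  The vector space operations on functionals are the pointwise ones of
  \<open>Function_Algebras\<close>.
\<close>

section \<open>Quasi-ordered *-algebras\<close>

text \<open>
  The sort of \<open>'a\<close> is that of unital rings without the axiom \<open>0 \<noteq> 1\<close> of \<open>ring_1\<close>, so that the zero
  algebra is not excluded.
\<close>

locale star_algebra =
  vector_space scal for scal :: "complex \<Rightarrow> 'a::{ring,monoid_mult} \<Rightarrow> 'a" +
  fixes star :: "'a \<Rightarrow> 'a"
  assumes scale_mult_left: "scal c a * b = scal c (a * b)"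
    and scale_mult_right: "a * scal c b = scal c (a * b)"
    and star_star: "star (star a) = a"
    and star_add: "star (a + b) = star a + star b"
    and star_scale: "star (scal c a) = scal (cnj c) (star a)"
    and star_mult: "star (a * b) = star b * star a"

definition hermitian :: "('a \<Rightarrow> 'a) \<Rightarrow> 'a set" where
  "hermitian star = {a. star a = a}"

text \<open>Only the restriction of \<open>qle\<close> to the Hermitian elements is meaningful.\<close>

locale quasi_ordered_star_algebra = star_algebra scal star
  for scal :: "complex \<Rightarrow> 'a::{ring,monoid_mult} \<Rightarrow> 'a" and star :: "'a \<Rightarrow> 'a" +
  fixes qle :: "'a \<Rightarrow> 'a \<Rightarrow> bool"
  assumes qle_refl: "reflp_on (hermitian star) qle"
    and qle_trans: "transp_on (hermitian star) qle"
    and qle_add: "\<lbrakk>a \<in> hermitian star; b \<in> hermitian star; c \<in> hermitian star; qle a b\<rbrakk>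
                    \<Longrightarrow> qle (a + c) (b + c)"
    and qle_conj: "\<lbrakk>a \<in> hermitian star; b \<in> hermitian star; qle a b\<rbrakk>
                    \<Longrightarrow> qle (star d * a * d) (star d * b * d)"
    and qle_zero_one: "qle 0 1"

definition positive_elements :: "('a \<Rightarrow> 'a) \<Rightarrow> ('a::zero \<Rightarrow> 'a \<Rightarrow> bool) \<Rightarrow> 'a set" where
  "positive_elements star qle = {a \<in> hermitian star. qle 0 a}"


section \<open>Functionals\<close>

definition dual_space :: "(complex \<Rightarrow> 'a::ab_group_add \<Rightarrow> 'a) \<Rightarrow> ('a \<Rightarrow> complex) set" where
  "dual_space scal = {\<omega>. Vector_Spaces.linear scal (*) \<omega>}"

definition fscale :: "complex \<Rightarrow> ('a \<Rightarrow> complex) \<Rightarrow> 'a \<Rightarrow> complex" where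
  "fscale c \<omega> = (\<lambda>a. c * \<omega> a)"

definition dual_star :: "('a \<Rightarrow> 'a) \<Rightarrow> ('a \<Rightarrow> complex) \<Rightarrow> 'a \<Rightarrow> complex" where
  "dual_star star \<omega> = (\<lambda>a. cnj (\<omega> (star a)))"

text \<open>\<open>bimodule_act b \<omega> c\<close> is $b \cdot \omega \cdot c$.\<close>

definition bimodule_act :: "'a::times \<Rightarrow> ('a \<Rightarrow> complex) \<Rightarrow> 'a \<Rightarrow> 'a \<Rightarrow> complex" where
  "bimodule_act b \<omega> c = (\<lambda>a. \<omega> (c * a * b))"

text \<open>\<open>conj_act star a \<omega>\<close> is $a \triangleright \omega$.\<close>

definition conj_act :: "('a \<Rightarrow> 'a) \<Rightarrow> 'a::times \<Rightarrow> ('a \<Rightarrow> complex) \<Rightarrow> 'a \<Rightarrow> complex" where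
  "conj_act star a \<omega> = bimodule_act a \<omega> (star a)"

text \<open>
  For a set \<open>\<Omega>\<close> of linear functionals, the two definitions below give $\Omega_{\mathrm H}$ and
  $\Omega_{\mathrm H}^+$.
\<close>

definition hermitian_functionals ::
    "('a \<Rightarrow> 'a) \<Rightarrow> ('a \<Rightarrow> complex) set \<Rightarrow> ('a \<Rightarrow> complex) set" where
  "hermitian_functionals star \<Omega> = {\<omega> \<in> \<Omega>. dual_star star \<omega> = \<omega>}"

definition dual_le ::
    "('a \<Rightarrow> 'a) \<Rightarrow> ('a::zero \<Rightarrow> 'a \<Rightarrow> bool) \<Rightarrow> ('a \<Rightarrow> complex) \<Rightarrow> ('a \<Rightarrow> complex) \<Rightarrow> bool" where
  "dual_le star qle \<omega> \<rho> \<longleftrightarrow> (\<forall>a \<in> positive_elements star qle. \<omega> a \<le> \<rho> a)"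

definition positive_functionals ::
    "('a \<Rightarrow> 'a) \<Rightarrow> ('a::zero \<Rightarrow> 'a \<Rightarrow> bool) \<Rightarrow> ('a \<Rightarrow> complex) set \<Rightarrow> ('a \<Rightarrow> complex) set" where
  "positive_functionals star qle \<Omega> = {\<omega> \<in> hermitian_functionals star \<Omega>. dual_le star qle 0 \<omega>}"

definition algebraically_positive :: "('a \<Rightarrow> 'a) \<Rightarrow> ('a::times \<Rightarrow> complex) \<Rightarrow> bool" where
  "algebraically_positive star \<omega> \<longleftrightarrow> (\<forall>a. 0 \<le> \<omega> (star a * a))"


section \<open>Abstract O*-algebras\<close>

locale abstract_Ostar_algebra = quasi_ordered_star_algebra scal star qle
  for scal :: "complex \<Rightarrow> 'a::{ring,monoid_mult} \<Rightarrow> 'a"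
    and star :: "'a \<Rightarrow> 'a"
    and qle :: "'a \<Rightarrow> 'a \<Rightarrow> bool" +
  fixes \<Omega> :: "('a \<Rightarrow> complex) set"
  assumes Omega_dual: "\<Omega> \<subseteq> dual_space scal"
    and Omega_subspace: "module.subspace fscale \<Omega>"
    and Omega_bimodule: "\<omega> \<in> \<Omega> \<Longrightarrow> bimodule_act b \<omega> c \<in> \<Omega>"
    and Omega_star: "\<omega> \<in> \<Omega> \<Longrightarrow> dual_star star \<omega> \<in> \<Omega>"
    and Omega_span: "\<Omega> = module.span fscale (positive_functionals star qle \<Omega>)"
    and positive_elements_eq:
      "positive_elements star qle =
        {a \<in> hermitian star. \<forall>\<omega> \<in> positive_functionals star qle \<Omega>. 0 \<le> \<omega> a}"

definition regular ::
    "('a \<Rightarrow> 'a) \<Rightarrow> ('a::{zero,times} \<Rightarrow> 'a \<Rightarrow> bool) \<Rightarrow> ('a \<Rightarrow> complex) set \<Rightarrow> bool" where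
  "regular star qle \<Omega> \<longleftrightarrow>
    (\<forall>\<omega> \<in> hermitian_functionals star \<Omega>.
       algebraically_positive star \<omega> \<longrightarrow> \<omega> \<in> positive_functionals star qle \<Omega>)"

definition states ::
    "('a \<Rightarrow> 'a) \<Rightarrow> ('a::{zero,one} \<Rightarrow> 'a \<Rightarrow> bool) \<Rightarrow> ('a \<Rightarrow> complex) set \<Rightarrow> ('a \<Rightarrow> complex) set" where
  "states star qle \<Omega> = {\<omega> \<in> positive_functionals star qle \<Omega>. \<omega> 1 = 1}"

text \<open>
  \<open>extreme_point_of\<close> needs a \<open>real_vector\<close> type, which \<open>'a \<Rightarrow> complex\<close> is not; this is its definition
  with \<open>open_segment\<close> unfolded.
\<close>

definition extreme_functionals :: "('a \<Rightarrow> complex) set \<Rightarrow> ('a \<Rightarrow> complex) set" where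
  "extreme_functionals S =
    {\<omega> \<in> S. \<forall>\<rho>\<in>S. \<forall>\<sigma>\<in>S.
       \<not> (\<rho> \<noteq> \<sigma> \<and> (\<exists>t::real. 0 < t \<and> t < 1 \<and>
             \<omega> = fscale (of_real (1 - t)) \<rho> + fscale (of_real t) \<sigma>))}"

definition pure_states ::
    "('a \<Rightarrow> 'a) \<Rightarrow> ('a::{zero,one} \<Rightarrow> 'a \<Rightarrow> bool) \<Rightarrow> ('a \<Rightarrow> complex) set \<Rightarrow> ('a \<Rightarrow> complex) set" where
  "pure_states star qle \<Omega> = extreme_functionals (states star qle \<Omega>)"

definition characters ::
    "('a \<Rightarrow> 'a) \<Rightarrow> ('a::{zero,one,times} \<Rightarrow> 'a \<Rightarrow> bool) \<Rightarrow> ('a \<Rightarrow> complex) set \<Rightarrow> ('a \<Rightarrow> complex) set" where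
  "characters star qle \<Omega> = {\<omega> \<in> states star qle \<Omega>. \<forall>a b. \<omega> (a * b) = \<omega> a * \<omega> b}"


section \<open>Bounded elements and the weak topology\<close>

text \<open>
  For a state \<open>\<omega>\<close> the number under the square root is real and nonnegative, so neither \<open>Re\<close> nor
  \<open>ennreal\<close> loses anything.
\<close>

definition norm_inf :: "('a \<Rightarrow> 'a) \<Rightarrow> ('a::times \<Rightarrow> complex) \<Rightarrow> 'a \<Rightarrow> ennreal" where
  "norm_inf star \<omega> a =
    (SUP b \<in> {b. \<omega> (star b * b) = 1}. ennreal (sqrt (Re (conj_act star b \<omega> (star a * a)))))"

definition bounded_wrt :: "('a \<Rightarrow> 'a) \<Rightarrow> ('a::times \<Rightarrow> complex) \<Rightarrow> 'a set" where
  "bounded_wrt star \<omega> = {a. norm_inf star \<omega> a < \<infinity>}"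

definition bounded_elements ::
    "('a \<Rightarrow> 'a) \<Rightarrow> ('a::{zero,one,times} \<Rightarrow> 'a \<Rightarrow> bool) \<Rightarrow> ('a \<Rightarrow> complex) set \<Rightarrow> 'a set" where
  "bounded_elements star qle \<Omega> = (\<Inter>\<omega> \<in> states star qle \<Omega>. bounded_wrt star \<omega>)"

text \<open>The open balls of the seminorms $a \mapsto |\langle\omega,a\rangle|$ form a subbasis.\<close>

definition weak_topology :: "('a::minus \<Rightarrow> complex) set \<Rightarrow> 'a topology" where
  "weak_topology \<Omega> =
    topology_generated_by {{x. cmod (\<omega> (x - a)) < e} |\<omega> a e. \<omega> \<in> \<Omega> \<and> (0::real) < e}"

end

theory Submission
  imports Defs
begin

text \<open>
  That characters are pure is a variance argument: if \<open>\<omega>\<close> is multiplicative, then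
  \<open>b = a - \<omega>(a) 1\<close> satisfies \<open>\<omega>(b\<^sup>* b) = 0\<close>, so every state occurring in a convex decomposition of
  \<open>\<omega>\<close> also vanishes on \<open>b\<^sup>* b\<close>, hence on \<open>b\<close> by the Cauchy--Schwarz inequality, and therefore
  agrees with \<open>\<omega>\<close> at \<open>a\<close>.

  The converse rests on the principle that a Hermitian functional in \<open>\<Omega>\<close> lying between \<open>0\<close> and a
  multiple of a pure state \<open>\<omega>\<close> on all squares \<open>b\<^sup>* b\<close> is itself a multiple of \<open>\<omega>\<close>
  (\<open>pure_dominated_multiple\<close>); regularity is what turns positivity on squares into
  positivity, so that the functional and its complement can be normalised to states.
  In the commutative case, boundedness of \<open>a\<close> says exactly that \<open>a \<triangleright> \<omega>\<close> is dominated by \<open>\<omega>\<close>,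
  so \<open>\<omega>(a\<^sup>* a x) = \<omega>(a\<^sup>* a) \<omega>(x)\<close>.  The translates \<open>a + \<i>\<^sup>k 1\<close> are again bounded, and
  polarisation gives \<open>\<omega>(a x) = \<omega>(a) \<omega>(x)\<close> for bounded \<open>a\<close> and arbitrary \<open>x\<close>.  Finally, for
  fixed \<open>x\<close> the functional \<open>a \<mapsto> \<omega>(a x) - \<omega>(a) \<omega>(x)\<close> belongs to \<open>\<Omega>\<close>, so it is weakly continuous
  and vanishes everywhere as soon as it vanishes on a weakly dense set.
\<close>

section \<open>Functionals and the degenerate Cauchy--Schwarz inequality\<close>

lemma module_fscale: "module (fscale :: complex \<Rightarrow> ('a \<Rightarrow> complex) \<Rightarrow> 'a \<Rightarrow> complex)"
  by unfold_locales (simp_all add: fscale_def fun_eq_iff algebra_simps)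

context star_algebra
begin

lemma star_one: "star 1 = 1"
  by (metis mult.left_neutral mult.right_neutral star_mult star_star)

lemma dual_space_add: "\<omega> \<in> dual_space scal \<Longrightarrow> \<omega> (a + b) = \<omega> a + \<omega> b"
  unfolding dual_space_def by (simp add: Vector_Spaces.linear_iff)

lemma dual_space_scale: "\<omega> \<in> dual_space scal \<Longrightarrow> \<omega> (scal c a) = c * \<omega> a"
  unfolding dual_space_def by (simp add: Vector_Spaces.linear_iff)

lemma dual_space_zero: "\<omega> \<in> dual_space scal \<Longrightarrow> \<omega> 0 = 0"
  using dual_space_add[of \<omega> 0 0] by simp

lemma dual_space_diff: "\<omega> \<in> dual_space scal \<Longrightarrow> \<omega> (a - b) = \<omega> a - \<omega> b"
  using dual_space_add[of \<omega> "a - b" b] by simp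

lemmas dual_space_simps =
  dual_space_add dual_space_scale dual_space_zero dual_space_diff

lemma hermitian_functional_star:
  assumes "dual_star star \<omega> = \<omega>"
  shows "\<omega> (star a) = cnj (\<omega> a)"
proof -
  have "cnj (\<omega> (star a)) = \<omega> a" using fun_cong[OF assms, of a] by (simp add: dual_star_def)
  then show ?thesis by (metis complex_cnj_cnj)
qed

lemma algebraically_positiveD:
  assumes "algebraically_positive star \<omega>"
  shows "Re (\<omega> (star b * b)) \<ge> 0" "Im (\<omega> (star b * b)) = 0"
  using assms by (auto simp: algebraically_positive_def less_eq_complex_def)

text \<open>
  The degenerate case of the Cauchy--Schwarz inequality: with \<open>w = \<omega>(b\<^sup>* c)\<close>, evaluating \<open>\<omega>\<close> at the
  square of \<open>b - s w\<^sup>- c\<close> (where \<open>w\<^sup>-\<close> is the conjugate) gives \<open>\<omega>(b\<^sup>* b) - 2 s |w|\<^sup>2 \<ge> 0\<close> for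
  all real \<open>s\<close>.
\<close>

lemma null_vector:
  assumes lin: "\<omega> \<in> dual_space scal" and herm: "dual_star star \<omega> = \<omega>"
    and pos: "algebraically_positive star \<omega>" and null: "\<omega> (star c * c) = 0"
  shows "\<omega> (star b * c) = 0"
proof (rule ccontr)
  define w where "w = \<omega> (star b * c)"
  assume "\<omega> (star b * c) \<noteq> 0"
  then have w: "(cmod w)\<^sup>2 > 0" by (simp add: w_def)
  have w': "\<omega> (star c * b) = cnj w"
    using hermitian_functional_star[OF herm, of "star b * c"]
    by (simp add: star_mult star_star w_def)
  \<comment> \<open>This choice makes \<open>2 s |w|\<^sup>2\<close> exceed \<open>\<omega>(b\<^sup>* b)\<close> by one.\<close>
  define s where "s = (Re (\<omega> (star b * b)) + 1) / (2 * (cmod w)\<^sup>2)"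
  define z where "z = - (of_real s * cnj w)"
  have "\<omega> (star (b + scal z c) * (b + scal z c)) = \<omega> (star b * b) + z * w + cnj z * cnj w"
    using lin null by (simp add: star_add star_scale scale_mult_left scale_mult_right
        distrib_left distrib_right dual_space_simps w' flip: w_def)
  moreover have "Re (z * w + cnj z * cnj w) = - (2 * s * (cmod w)\<^sup>2)"
    by (simp add: z_def cmod_power2) (simp add: algebra_simps power2_eq_square)
  moreover have "Re (\<omega> (star (b + scal z c) * (b + scal z c))) \<ge> 0"
    using pos by (rule algebraically_positiveD)
  ultimately have "2 * s * (cmod w)\<^sup>2 \<le> Re (\<omega> (star b * b))" by (simp add: add.assoc)
  then show False using w by (simp add: s_def)
qed

section \<open>Bounded elements\<close>

text \<open>
  The supremum defining the norm ranges over normalised vectors only.  Rescaling covers the \<open>b\<close>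
  with \<open>\<omega>(b\<^sup>* b) > 0\<close>; for null vectors both sides vanish by the Cauchy--Schwarz inequality.
\<close>

lemma bounded_wrt_iff:
  assumes lin: "\<omega> \<in> dual_space scal" and herm: "dual_star star \<omega> = \<omega>"
    and pos: "algebraically_positive star \<omega>"
  shows "a \<in> bounded_wrt star \<omega> \<longleftrightarrow>
    (\<exists>C\<ge>0. \<forall>b. Re (\<omega> (star b * (star a * a) * b)) \<le> C * Re (\<omega> (star b * b)))"
    (is "_ \<longleftrightarrow> ?R")
proof
  assume "a \<in> bounded_wrt star \<omega>"
  then have fin: "norm_inf star \<omega> a < \<infinity>" by (simp add: bounded_wrt_def)
  define K where "K = enn2real (norm_inf star \<omega> a)"
  have K0: "K \<ge> 0" by (simp add: K_def)
  have K: "Re (\<omega> (star b * (star a * a) * b)) \<le> K\<^sup>2" if "\<omega> (star b * b) = 1" for b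
  proof -
    let ?v = "Re (\<omega> (star b * (star a * a) * b))"
    have "ennreal (sqrt ?v) \<le> norm_inf star \<omega> a"
      unfolding norm_inf_def using that
      by (intro SUP_upper2[of b]) (auto simp: conj_act_def bimodule_act_def)
    also have "\<dots> = ennreal K" using fin by (simp add: K_def)
    finally have "sqrt ?v \<le> K" using K0 by (simp add: ennreal_le_iff)
    then show ?thesis by (rule sqrt_le_D)
  qed
  show ?R
  proof (intro exI[of _ "K\<^sup>2"] conjI allI)
    fix b
    note re = algebraically_positiveD[OF pos, of b]
    show "Re (\<omega> (star b * (star a * a) * b)) \<le> K\<^sup>2 * Re (\<omega> (star b * b))"
    proof (cases "Re (\<omega> (star b * b)) = 0")
      case True
      then have "\<omega> (star b * b) = 0" using re by (simp add: complex_eq_iff)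
      from null_vector[OF lin herm pos this, of "star a * a * b"]
      show ?thesis using True by (simp add: star_mult star_star mult.assoc)
    next
      case False
      define r where "r = Re (\<omega> (star b * b))"
      define q where "q = complex_of_real (1 / sqrt r)"
      have r: "r > 0" using False re by (simp add: r_def)
      have qq: "cnj q * q = of_real (1 / r)"
        unfolding q_def using r by (simp flip: of_real_mult)
      have "\<omega> (star (scal q b) * scal q b) = cnj q * q * \<omega> (star b * b)"
        using lin by (simp add: star_scale scale_mult_left scale_mult_right dual_space_simps)
      also have "\<dots> = 1" using re r unfolding qq by (simp add: complex_eq_iff flip: r_def)
      finally have "Re (\<omega> (star (scal q b) * (star a * a) * scal q b)) \<le> K\<^sup>2" by (rule K)
      also have "\<omega> (star (scal q b) * (star a * a) * scal q b) =
          cnj q * q * \<omega> (star b * (star a * a) * b)"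
        using lin by (simp add: star_scale scale_mult_left scale_mult_right dual_space_simps)
      finally show ?thesis using r unfolding qq by (simp add: field_simps flip: r_def)
    qed
  qed simp
next
  assume ?R
  then obtain C where C: "C \<ge> 0"
    "\<And>b. Re (\<omega> (star b * (star a * a) * b)) \<le> C * Re (\<omega> (star b * b))" by blast
  have "norm_inf star \<omega> a \<le> ennreal (sqrt C)"
    unfolding norm_inf_def
  proof (rule SUP_least)
    fix b assume "b \<in> {b. \<omega> (star b * b) = 1}"
    then show "ennreal (sqrt (Re (conj_act star b \<omega> (star a * a)))) \<le> ennreal (sqrt C)"
      using C(2)[of b] by (intro ennreal_leI) (simp add: conj_act_def bimodule_act_def)
  qed
  then show "a \<in> bounded_wrt star \<omega>"
    by (simp add: bounded_wrt_def) (metis ennreal_less_top infinity_ennreal_def le_less_trans)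
qed

text \<open>
  By the parallelogram law, the values of \<open>\<omega>\<close> at the squares of \<open>(a + c) b\<close> and \<open>(a - c) b\<close> add
  up to \<open>2 \<omega>(b\<^sup>* a\<^sup>* a b) + 2 |c|\<^sup>2 \<omega>(b\<^sup>* b)\<close>, and the second of them is nonnegative.
\<close>

lemma bounded_wrt_translate:
  assumes lin: "\<omega> \<in> dual_space scal" and herm: "dual_star star \<omega> = \<omega>"
    and pos: "algebraically_positive star \<omega>" and a: "a \<in> bounded_wrt star \<omega>"
  shows "a + scal c 1 \<in> bounded_wrt star \<omega>"
proof -
  obtain C where C: "C \<ge> 0"
    "\<And>b. Re (\<omega> (star b * (star a * a) * b)) \<le> C * Re (\<omega> (star b * b))"
    using a bounded_wrt_iff[OF lin herm pos] by blast
  have "Re (\<omega> (star b * (star (a + scal c 1) * (a + scal c 1)) * b))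
      \<le> (2 * C + 2 * (cmod c)\<^sup>2) * Re (\<omega> (star b * b))" for b
  proof -
    define d where "d = a - scal c 1"
    have star_diff: "star (x - y) = star x - star y" for x y
      using star_add[of "x - y" y] by (simp add: algebra_simps)
    have "\<omega> (star b * (star (a + scal c 1) * (a + scal c 1)) * b) + \<omega> (star (d * b) * (d * b))
        = 2 * \<omega> (star b * (star a * a) * b) + 2 * (c * cnj c) * \<omega> (star b * b)"
      using lin unfolding d_def
      by (simp add: star_mult star_add star_diff star_scale star_one scale_mult_left
          scale_mult_right ring_distribs dual_space_simps mult.assoc algebra_simps)
    then have "\<omega> (star b * (star (a + scal c 1) * (a + scal c 1)) * b) + \<omega> (star (d * b) * (d * b))
        = 2 * \<omega> (star b * (star a * a) * b) + of_real (2 * (cmod c)\<^sup>2) * \<omega> (star b * b)"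
      by (simp only: of_real_mult of_real_numeral complex_norm_square)
    from arg_cong[where f = Re, OF this]
    have "Re (\<omega> (star b * (star (a + scal c 1) * (a + scal c 1)) * b))
        + Re (\<omega> (star (d * b) * (d * b)))
        = 2 * Re (\<omega> (star b * (star a * a) * b)) + 2 * (cmod c)\<^sup>2 * Re (\<omega> (star b * b))"
      by (simp del: of_real_mult)
    moreover have "Re (\<omega> (star (d * b) * (d * b))) \<ge> 0"
      using pos by (rule algebraically_positiveD)
    ultimately show ?thesis using C(2)[of b] by (simp add: distrib_right)
  qed
  with C(1) show ?thesis
    by (subst bounded_wrt_iff[OF lin herm pos])
      (intro exI[of _ "2 * C + 2 * (cmod c)\<^sup>2"], auto)
qed

text \<open>
  Polarisation against the unit: it makes every element a combination of squares of its own
  translates by scalars, so that bounded elements are spanned by squares of bounded elements.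
\<close>

lemma polarization_one:
  "scal 4 a = star (a + scal 1 1) * (a + scal 1 1)
     + scal \<i> (star (a + scal \<i> 1) * (a + scal \<i> 1))
     + scal (-1) (star (a + scal (-1) 1) * (a + scal (-1) 1))
     + scal (-\<i>) (star (a + scal (-\<i>) 1) * (a + scal (-\<i>) 1))"
proof -
  have expand: "star (a + scal c 1) * (a + scal c 1) =
      star a * a + scal c (star a) + scal (cnj c) a + scal (cnj c * c) 1" for c
    by (simp add: star_add star_scale star_one scale_mult_left scale_mult_right ring_distribs
        scale_right_distrib mult.commute)
  have "scal 4 a = scal (1 + 1 + 1 + 1) a" by simp
  also have "\<dots> = a + a + a + a" by (simp only: scale_left_distrib scale_one)
  finally show ?thesis
    unfolding expand by (simp add: scale_right_distrib scale_right_diff_distrib)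
qed

end

section \<open>Characters are pure\<close>

context abstract_Ostar_algebra
begin

lemma Omega_diff: "\<omega> \<in> \<Omega> \<Longrightarrow> \<rho> \<in> \<Omega> \<Longrightarrow> \<omega> - \<rho> \<in> \<Omega>"
  by (rule module.subspace_diff[OF module_fscale Omega_subspace])

lemma Omega_scale: "\<omega> \<in> \<Omega> \<Longrightarrow> fscale c \<omega> \<in> \<Omega>"
  by (rule module.subspace_scale[OF module_fscale Omega_subspace])

lemma positive_functional_algebraically_positive:
  assumes "\<omega> \<in> positive_functionals star qle \<Omega>"
  shows "algebraically_positive star \<omega>"
  unfolding algebraically_positive_def
proof
  fix a
  have "star 0 = 0" using star_add[of 0 0] by simp
  then have "qle (star a * 0 * a) (star a * 1 * a)"
    by (intro qle_conj qle_zero_one) (auto simp: hermitian_def star_one)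
  then have "star a * a \<in> positive_elements star qle"
    by (simp add: positive_elements_def hermitian_def star_mult star_star)
  then show "0 \<le> \<omega> (star a * a)"
    using assms by (auto simp: positive_functionals_def dual_le_def)
qed

lemma statesD:
  assumes "\<omega> \<in> states star qle \<Omega>"
  shows "\<omega> \<in> \<Omega>" "\<omega> \<in> dual_space scal" "dual_star star \<omega> = \<omega>"
    "algebraically_positive star \<omega>" "\<omega> 1 = 1"
  using assms Omega_dual positive_functional_algebraically_positive
  by (auto simp: states_def positive_functionals_def hermitian_functionals_def)

lemma regular_stateI:
  assumes "regular star qle \<Omega>" "\<omega> \<in> \<Omega>" "dual_star star \<omega> = \<omega>"
    "algebraically_positive star \<omega>" "\<omega> 1 = 1"
  shows "\<omega> \<in> states star qle \<Omega>"
  using assms by (auto simp: regular_def states_def hermitian_functionals_def)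

text \<open>
  A component of a convex decomposition of the character \<open>\<omega>\<close> vanishes on the variance
  \<open>b\<^sup>* b\<close>, where \<open>b = a - \<omega>(a) 1\<close>, because positive multiples of both components add up to
  \<open>\<omega>(b\<^sup>* b) = 0\<close>.
\<close>

lemma character_decomposition:
  assumes ch: "\<omega> \<in> characters star qle \<Omega>"
    and \<rho>: "\<rho> \<in> states star qle \<Omega>" and \<sigma>: "\<sigma> \<in> states star qle \<Omega>"
    and t: "0 < t" "t < 1"
    and eq: "\<omega> = fscale (of_real (1 - t)) \<rho> + fscale (of_real t) \<sigma>"
  shows "\<rho> = \<omega>"
proof
  fix a
  have \<omega>: "\<omega> \<in> states star qle \<Omega>" and mul: "\<And>a b. \<omega> (a * b) = \<omega> a * \<omega> b"
    using ch by (auto simp: characters_def)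
  define b where "b = a - scal (\<omega> a) 1"
  have "\<omega> b = 0" using statesD[OF \<omega>] by (simp add: b_def dual_space_simps)
  then have "\<omega> (star b * b) = 0" by (simp add: mul)
  then have sum: "(1 - t) * Re (\<rho> (star b * b)) + t * Re (\<sigma> (star b * b)) = 0"
    by (subst (asm) eq) (simp add: fscale_def complex_eq_iff)
  have nonneg: "\<rho> (star b * b) \<ge> 0" "\<sigma> (star b * b) \<ge> 0"
    using statesD(4)[OF \<rho>] statesD(4)[OF \<sigma>] by (auto simp: algebraically_positive_def)
  have "(1 - t) * Re (\<rho> (star b * b)) \<ge> 0" "t * Re (\<sigma> (star b * b)) \<ge> 0"
    using nonneg t by (auto simp: less_eq_complex_def)
  then have "(1 - t) * Re (\<rho> (star b * b)) = 0" using sum by linarith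
  then have "\<rho> (star b * b) = 0"
    using nonneg t by (simp add: less_eq_complex_def complex_eq_iff)
  from null_vector[OF statesD(2-4)[OF \<rho>] this, of 1]
  have "\<rho> b = 0" by (simp add: star_one)
  then show "\<rho> a = \<omega> a"
    using statesD[OF \<rho>] by (simp add: b_def dual_space_simps)
qed

lemma characters_subset_pure_states:
  "characters star qle \<Omega> \<subseteq> pure_states star qle \<Omega>"
proof
  fix \<omega> assume ch: "\<omega> \<in> characters star qle \<Omega>"
  have "\<rho> = \<sigma>" if "\<rho> \<in> states star qle \<Omega>" "\<sigma> \<in> states star qle \<Omega>" "0 < t" "t < 1"
    "\<omega> = fscale (of_real (1 - t)) \<rho> + fscale (of_real t) \<sigma>" for \<rho> \<sigma> t
  proof -
    have "\<rho> = \<omega>" using ch that by (rule character_decomposition)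
    moreover have "\<sigma> = \<omega>"
    proof (rule character_decomposition[OF ch that(2,1)])
      show "0 < 1 - t" "1 - t < 1" using that(3,4) by simp_all
      show "\<omega> = fscale (of_real (1 - (1 - t))) \<sigma> + fscale (of_real (1 - t)) \<rho>"
        by (subst that(5)) (simp add: add.commute)
    qed
    ultimately show ?thesis by simp
  qed
  moreover have "\<omega> \<in> states star qle \<Omega>" using ch by (simp add: characters_def)
  ultimately show "\<omega> \<in> pure_states star qle \<Omega>"
    unfolding pure_states_def extreme_functionals_def by blast
qed

section \<open>Pure states are multiplicative on bounded elements\<close>

text \<open>
  If \<open>\<rho>(1) = 0\<close>, then \<open>\<rho> = 0\<close> by the Cauchy--Schwarz inequality.  Otherwise \<open>\<omega>\<close> is a proper
  convex combination of the normalisations of \<open>\<rho>\<close> and of \<open>\<omega> - \<rho> / (C + 1)\<close>, both of which are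
  states by regularity.
\<close>

lemma pure_dominated_multiple:
  assumes reg: "regular star qle \<Omega>" and pure: "\<omega> \<in> pure_states star qle \<Omega>"
    and \<rho>: "\<rho> \<in> \<Omega>" and herm: "dual_star star \<rho> = \<rho>"
    and pos: "algebraically_positive star \<rho>"
    and C: "C \<ge> 0" and dom: "\<And>b. Re (\<rho> (star b * b)) \<le> C * Re (\<omega> (star b * b))"
  shows "\<rho> = fscale (\<rho> 1) \<omega>"
proof -
  have \<omega>: "\<omega> \<in> states star qle \<Omega>"
    using pure by (simp add: pure_states_def extreme_functionals_def)
  have lin: "\<rho> \<in> dual_space scal" using \<rho> Omega_dual by blast
  define r where "r = Re (\<rho> 1)"
  note sq = algebraically_positiveD[OF pos] algebraically_positiveD[OF statesD(4)[OF \<omega>]]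
  have r: "\<rho> 1 = of_real r" "r \<ge> 0"
    using sq(1,2)[of 1] by (simp_all add: star_one r_def complex_eq_iff)
  have rC: "r \<le> C" using dom[of 1] statesD(5)[OF \<omega>] by (simp add: star_one r_def)
  show ?thesis
  proof (cases "r = 0")
    case True
    then have "\<rho> (star 1 * 1) = 0" using r by (simp add: star_one)
    from null_vector[OF lin herm pos this]
    have "\<rho> x = 0" for x by (metis mult.right_neutral star_star)
    then show ?thesis by (simp add: fun_eq_iff fscale_def)
  next
    case False
    \<comment> \<open>Dividing by \<open>C + 1\<close> rather than \<open>C\<close> keeps the weight below one even if \<open>\<rho>(1) = C\<close>.\<close>
    define t where "t = r / (C + 1)"
    have t: "0 < t" "t < 1" using False r rC C by (auto simp: t_def field_simps)
    define \<sigma> where "\<sigma> = fscale (of_real (1 / r)) \<rho>"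
    define \<tau> where
      "\<tau> = fscale (of_real (1 / (1 - t))) (\<omega> - fscale (of_real (1 / (C + 1))) \<rho>)"
    have \<sigma>_state: "\<sigma> \<in> states star qle \<Omega>"
    proof (rule regular_stateI[OF reg])
      show "\<sigma> \<in> \<Omega>" by (simp add: \<sigma>_def Omega_scale \<rho>)
      show "dual_star star \<sigma> = \<sigma>"
        using herm by (simp add: \<sigma>_def dual_star_def fscale_def fun_eq_iff)
      show "algebraically_positive star \<sigma>"
        using sq(1,2) r by (simp add: algebraically_positive_def \<sigma>_def fscale_def less_eq_complex_def)
      show "\<sigma> 1 = 1" using False r by (simp add: \<sigma>_def fscale_def)
    qed
    have \<tau>_state: "\<tau> \<in> states star qle \<Omega>"
    proof (rule regular_stateI[OF reg])
      show "\<tau> \<in> \<Omega>" by (simp add: \<tau>_def Omega_scale Omega_diff \<rho> statesD(1)[OF \<omega>])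
      show "dual_star star \<tau> = \<tau>"
        using herm statesD(3)[OF \<omega>] by (simp add: \<tau>_def dual_star_def fscale_def fun_eq_iff)
      show "algebraically_positive star \<tau>"
        unfolding algebraically_positive_def
      proof
        fix b
        define u v where "u = Re (\<omega> (star b * b))" and "v = Re (\<rho> (star b * b))"
        have uv: "u \<ge> 0" "v \<le> C * u" using sq(3) dom by (auto simp: u_def v_def)
        have "v / (C + 1) \<le> u" using uv C by (simp add: field_simps)
        then have "(1 / (1 - t)) * (u - 1 / (C + 1) * v) \<ge> 0" using t by simp
        then have "complex_of_real ((1 / (1 - t)) * (u - 1 / (C + 1) * v)) \<ge> 0"
          by (simp only: less_eq_complex_def) simp
        also have "complex_of_real ((1 / (1 - t)) * (u - 1 / (C + 1) * v)) = \<tau> (star b * b)"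
          using sq(2,4)[of b] by (simp add: \<tau>_def fscale_def u_def v_def complex_eq_iff)
        finally show "0 \<le> \<tau> (star b * b)" .
      qed
      have "\<tau> 1 = of_real ((1 / (1 - t)) * (1 - 1 / (C + 1) * r))"
        using statesD(5)[OF \<omega>] r by (simp add: \<tau>_def fscale_def)
      also have "1 - 1 / (C + 1) * r = 1 - t" by (simp add: t_def)
      also have "1 / (1 - t) * (1 - t) = 1" using t by simp
      finally show "\<tau> 1 = 1" by simp
    qed
    have "\<omega> = fscale (of_real (1 - t)) \<tau> + fscale (of_real t) \<sigma>"
    proof
      fix x
      have norm_\<tau>: "complex_of_real (1 - t) * of_real (1 / (1 - t)) = 1"
        unfolding of_real_mult[symmetric] using t by simp
      have norm_\<sigma>: "complex_of_real t * of_real (1 / r) = of_real (1 / (C + 1))"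
        unfolding of_real_mult[symmetric] using False by (simp add: t_def)
      show "\<omega> x = (fscale (of_real (1 - t)) \<tau> + fscale (of_real t) \<sigma>) x"
        unfolding \<tau>_def \<sigma>_def fscale_def plus_fun_apply fun_diff_def mult.assoc[symmetric]
          norm_\<tau> norm_\<sigma> by simp
    qed
    with pure \<sigma>_state \<tau>_state t have "\<tau> = \<sigma>" and eq: "\<omega> = fscale (of_real (1 - t)) \<tau> + fscale (of_real t) \<sigma>"
      unfolding pure_states_def extreme_functionals_def by blast+
    then have "\<omega> = \<sigma>" by (simp add: fscale_def fun_eq_iff algebra_simps)
    then show ?thesis using False r by (simp add: \<sigma>_def fscale_def fun_eq_iff)
  qed
qed

text \<open>
  For bounded \<open>a\<close> the functional \<open>a \<triangleright> \<omega>\<close> is dominated by \<open>\<omega>\<close>, hence equals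
  \<open>\<omega>(a\<^sup>* a) \<omega>\<close>.
\<close>

lemma pure_multiplicative_square:
  assumes comm: "\<And>a b :: 'a. a * b = b * a"
    and reg: "regular star qle \<Omega>" and pure: "\<omega> \<in> pure_states star qle \<Omega>"
    and a: "a \<in> bounded_wrt star \<omega>"
  shows "\<omega> (star a * a * x) = \<omega> (star a * a) * \<omega> x"
proof -
  have \<omega>: "\<omega> \<in> states star qle \<Omega>"
    using pure by (simp add: pure_states_def extreme_functionals_def)
  define \<rho> where "\<rho> = conj_act star a \<omega>"
  have \<rho>: "\<rho> y = \<omega> (star a * y * a)" for y
    by (simp add: \<rho>_def conj_act_def bimodule_act_def)
  have square: "star a * (star b * b) * a = star (b * a) * (b * a)" for b
    by (simp add: star_mult mult.assoc)
  \<comment> \<open>Boundedness of \<open>a\<close> controls \<open>b \<triangleright> \<omega>\<close> at \<open>a\<^sup>* a\<close>; by commutativity this is the value of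
    \<open>a \<triangleright> \<omega>\<close> at \<open>b\<^sup>* b\<close>.\<close>
  have swap: "star a * (star b * b) * a = star b * (star a * a) * b" for b
    by (metis comm mult.assoc)
  obtain C where C: "C \<ge> 0"
    "\<And>b. Re (\<omega> (star b * (star a * a) * b)) \<le> C * Re (\<omega> (star b * b))"
    using a bounded_wrt_iff[OF statesD(2-4)[OF \<omega>]] by blast
  have "\<rho> = fscale (\<rho> 1) \<omega>"
  proof (rule pure_dominated_multiple[OF reg pure])
    show "\<rho> \<in> \<Omega>" by (simp add: \<rho>_def conj_act_def Omega_bimodule statesD(1)[OF \<omega>])
    show "dual_star star \<rho> = \<rho>"
    proof
      fix y
      show "dual_star star \<rho> y = \<rho> y"
        using hermitian_functional_star[OF statesD(3)[OF \<omega>], of "star a * y * a"]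
        by (simp add: dual_star_def \<rho> star_mult star_star mult.assoc)
    qed
    show "algebraically_positive star \<rho>"
      using statesD(4)[OF \<omega>] by (simp add: algebraically_positive_def \<rho> square)
    show "C \<ge> 0" by fact
    show "Re (\<rho> (star b * b)) \<le> C * Re (\<omega> (star b * b))" for b
      using C(2) by (simp add: \<rho> swap)
  qed
  from fun_cong[OF this, of x] have "\<rho> x = \<rho> 1 * \<omega> x" unfolding fscale_def .
  moreover have "star a * x * a = star a * a * x" by (metis comm mult.assoc)
  ultimately show ?thesis by (simp add: \<rho>)
qed

lemma pure_multiplicative_bounded:
  assumes comm: "\<And>a b :: 'a. a * b = b * a"
    and reg: "regular star qle \<Omega>" and pure: "\<omega> \<in> pure_states star qle \<Omega>"
    and a: "a \<in> bounded_wrt star \<omega>"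
  shows "\<omega> (a * x) = \<omega> a * \<omega> x"
proof -
  have \<omega>: "\<omega> \<in> states star qle \<Omega>"
    using pure by (simp add: pure_states_def extreme_functionals_def)
  note lin = statesD(2)[OF \<omega>]
  define s where "s c = star (a + scal c 1) * (a + scal c 1)" for c
  have s: "\<omega> (s c * x) = \<omega> (s c) * \<omega> x" for c
    unfolding s_def using bounded_wrt_translate[OF statesD(2-4)[OF \<omega>] a]
    by (rule pure_multiplicative_square[OF comm reg pure])
  have pol: "scal 4 a = s 1 + scal \<i> (s \<i>) + scal (-1) (s (-1)) + scal (-\<i>) (s (-\<i>))"
    unfolding s_def by (rule polarization_one)
  have "4 * \<omega> (a * x) = \<omega> (scal 4 a * x)"
    using lin by (simp add: scale_mult_left dual_space_scale)
  also have "\<dots> = \<omega> (scal 4 a) * \<omega> x"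
    unfolding pol distrib_right scale_mult_left dual_space_add[OF lin] dual_space_scale[OF lin] s
    by (simp only: distrib_right mult.assoc)
  also have "\<dots> = 4 * (\<omega> a * \<omega> x)" using lin by (simp add: dual_space_scale)
  finally show ?thesis by simp
qed

section \<open>Extension from a weakly dense set\<close>

lemma Omega_zero_on_weakly_dense:
  assumes \<phi>: "\<phi> \<in> \<Omega>" and dense: "weak_topology \<Omega> closure_of B = UNIV"
    and B: "\<And>b. b \<in> B \<Longrightarrow> \<phi> b = 0"
  shows "\<phi> a = 0"
proof (rule ccontr)
  assume "\<phi> a \<noteq> 0"
  have lin: "\<phi> \<in> dual_space scal" using \<phi> Omega_dual by blast
  define U where "U = {x. cmod (\<phi> (x - a)) < cmod (\<phi> a)}"
  have "openin (weak_topology \<Omega>) U"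
    unfolding weak_topology_def U_def using \<phi> \<open>\<phi> a \<noteq> 0\<close>
    by (intro topology_generated_by_Basis) force
  moreover have "a \<in> U" using \<open>\<phi> a \<noteq> 0\<close> lin by (simp add: U_def dual_space_zero)
  moreover have "a \<in> weak_topology \<Omega> closure_of B" using dense by simp
  ultimately obtain b where "b \<in> B" "b \<in> U" by (auto simp: in_closure_of)
  then show False using B lin by (simp add: U_def dual_space_diff)
qed

end

theorem theorem4p8:
  fixes scal :: "complex \<Rightarrow> 'a::{ring,monoid_mult} \<Rightarrow> 'a"
    and star :: "'a \<Rightarrow> 'a"
    and qle :: "'a \<Rightarrow> 'a \<Rightarrow> bool"
    and \<Omega> :: "('a \<Rightarrow> complex) set"
  assumes "abstract_Ostar_algebra scal star qle \<Omega>"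
    and commutative: "\<And>a b :: 'a. a * b = b * a"
    and "regular star qle \<Omega>"
    and dense: "weak_topology \<Omega> closure_of bounded_elements star qle \<Omega> = UNIV"
  shows "pure_states star qle \<Omega> = characters star qle \<Omega>"
proof
  interpret abstract_Ostar_algebra scal star qle \<Omega> by fact
  show "characters star qle \<Omega> \<subseteq> pure_states star qle \<Omega>"
    by (rule characters_subset_pure_states)
  show "pure_states star qle \<Omega> \<subseteq> characters star qle \<Omega>"
  proof
    fix \<omega> assume pure: "\<omega> \<in> pure_states star qle \<Omega>"
    then have \<omega>: "\<omega> \<in> states star qle \<Omega>"
      by (simp add: pure_states_def extreme_functionals_def)
    have "\<omega> (a * x) = \<omega> a * \<omega> x" for a x
    proof -
      define \<phi> where "\<phi> = bimodule_act x \<omega> 1 - fscale (\<omega> x) \<omega>"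
      have "\<phi> \<in> \<Omega>" unfolding \<phi>_def
        by (intro Omega_diff Omega_bimodule Omega_scale statesD(1)[OF \<omega>])
      moreover have "\<phi> b = 0" if "b \<in> bounded_elements star qle \<Omega>" for b
      proof -
        have "b \<in> bounded_wrt star \<omega>" using that \<omega> by (auto simp: bounded_elements_def)
        then have "\<omega> (b * x) = \<omega> b * \<omega> x"
          by (rule pure_multiplicative_bounded[OF commutative \<open>regular star qle \<Omega>\<close> pure])
        then show ?thesis by (simp add: \<phi>_def bimodule_act_def fscale_def)
      qed
      ultimately have "\<phi> a = 0" using Omega_zero_on_weakly_dense[OF _ dense] by blast
      then show ?thesis by (simp add: \<phi>_def bimodule_act_def fscale_def)
    qed
    with \<omega> show "\<omega> \<in> characters star qle \<Omega>" by (simp add: characters_def)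
  qed
qed

end
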